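(* Let $\Omega\subset\mathbb{X}$ be a closed set, let $r\in\{1,\ldots,n\}$, and suppose $\Gamma_r:=\{X\in\Omega\,|\,\mathrm{rank}(X)\le r\}$ is nonempty. Consider any $\overline{X}\in\Gamma_r$. The mapping $\mathcal{S}_r$ is calm at $0$ for $\overline{X}$ if and only if either of the following equivalent conditions holds: (i) there exists a constant $\gamma\ge 0$ along with $\delta>0$ such that for all $X\in\mathbb{X}$ with $\|X-\overline{X}\|_F\le\delta$, $$\mathrm{dist}(X,\Gamma_r)\le\gamma\big[\mathrm{dist}(X,\Omega)+\mathrm{dist}(X,\Lambda_r)\big];$$ (ii) the multifunction $\mathcal{F}_r:\mathbb{X}\times\mathbb{X}\rightrightarrows\mathbb{X}$ defined by $\mathcal{F}_r(X,Y):=\{X-Y\}$ if $(X,Y)\in\Omega\times\Lambda_r$ and $\mathcal{F}_r(X,Y):=\emptyset$ otherwise is subregular at $(\overline{X},\overline{X})$ for the origin. Consequently, for any $\overline{X}\in\Gamma_r$, the calmness of $\mathcal{S}_r$ at $0$ for $\overline{X}$ is implied by the condition $$[-\mathcal{N}_{\Omega}(\overline{X})]\cap\mathcal{N}_{\Lambda_r}(\overline{X})=\{0\}.$$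
   Context: $\mathbb{X}$ denotes either $\mathbb{R}^{n\times m}$ (with $n\le m$) or the space $\mathbb{S}^n$ of $n\times n$ real symmetric matrices, equipped with the trace inner product and the Frobenius norm $\|\cdot\|_F$. $\Lambda_r:=\{X\in\mathbb{X}\,|\,\mathrm{rank}(X)\le r\}$. $\sigma_1(X)\ge\cdots\ge\sigma_n(X)$ are the singular values of $X$; $\|X\|_*=\sum_{i=1}^n\sigma_i(X)$ is the nuclear norm and $\|X\|_{(r)}=\sum_{i=1}^r\sigma_i(X)$ is the Ky-Fan $r$-norm. The multifunction $\mathcal{S}_r:\mathbb{R}\rightrightarrows\mathbb{X}$ is $\mathcal{S}_r(\tau):=\{X\in\Omega\,|\,\|X\|_*-\|X\|_{(r)}=\tau\}$, so $\mathcal{S}_r(0)=\Gamma_r$. $\mathrm{dist}(X,C)$ is the Frobenius-norm distance from $X$ to $C$, with $\mathrm{dist}(X,\emptyset)=+\infty$. Calmness: a multifunction $\mathcal{M}:\mathbb{Y}\rightrightarrows\mathbb{Z}$ between finite-dimensional Euclidean spaces is calm at $\overline{y}$ for $\overline{z}\in\mathcal{M}(\overline{y})$ if there exist $\gamma\ge0$, $\varepsilon>0$, $\delta>0$ such that for all $y$ with $\|y-\overline{y}\|\le\varepsilon$, $\mathcal{M}(y)\cap\mathbb{B}(\overline{z},\delta)\subseteq\mathcal{M}(\overline{y})+\gamma\|y-\overline{y}\|\mathbb{B}_{\mathbb{Z}}$, where $\mathbb{B}(\overline z,\delta)$ is the closed ball and $\mathbb{B}_{\mathbb{Z}}$ the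 closed unit ball. Subregularity: $\mathcal{F}:\mathbb{Z}\rightrightarrows\mathbb{Y}$ is (metrically) subregular at $\overline{z}$ for $\overline{y}\in\mathcal{F}(\overline{z})$ if there exist $\kappa\ge0$ and $\varepsilon>0$ such that $\mathrm{dist}(z,\mathcal{F}^{-1}(\overline{y}))\le\kappa\,\mathrm{dist}(\overline{y},\mathcal{F}(z))$ for all $z\in\mathbb{B}(\overline{z},\varepsilon)$. Normal cones: for a closed set $S\subseteq\mathbb{X}$ and $\overline{x}\in S$, the Fréchet normal cone is $\widehat{\mathcal{N}}_S(\overline{x}):=\{v\in\mathbb{X}\,|\,\limsup_{x\to\overline{x},\,x\in S,\,x\ne\overline{x}}\langle v,x-\overline{x}\rangle/\|x-\overline{x}\|\le0\}$, and the limiting normal cone $\mathcal{N}_S(\overline{x})$ is the set of $v$ for which there exist $x^k\in S$, $x^k\to\overline{x}$, and $v^k\in\widehat{\mathcal{N}}_S(x^k)$ with $v^k\to v$. *)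

theory Defs
  imports "HOL-Analysis.Analysis" "HOL-Computational_Algebra.Polynomial" "HOL-Library.Multiset"
begin

text \<open>
  A real matrix with rows indexed by \<open>'n\<close> and columns indexed by \<open>'m\<close> is an element of
  \<open>real^'m^'n\<close>, whose library inner product and norm are the trace inner product and the Frobenius
  norm. The matrix space \<open>\<X>\<close> is passed as a linear subspace \<open>V\<close> of that type: \<open>UNIV\<close> for the
  rectangular matrices, \<open>sym_matrices\<close> for the symmetric ones. Balls, normal vectors and inverse
  images are all taken inside \<open>V\<close>.
\<close>

definition sym_matrices :: "(real^'n^'n) set" where
  "sym_matrices = {X. transpose X = X}"


subsection \<open>Singular values\<close>

definition charpoly :: "real^'n^'n \<Rightarrow> real poly" where
  "charpoly A = det (mat [:0, 1:] - map_matrix (\<lambda>a. [:a:]) A)"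

text \<open>
  The square roots of the eigenvalues of \<open>X X\<^sup>T\<close>, with algebraic multiplicity, in nonincreasing order.
  As \<open>X X\<^sup>T\<close> is symmetric positive semidefinite of order \<open>CARD('n)\<close>, there are \<open>CARD('n)\<close> of them;
  for \<open>CARD('n) \<le> CARD('m)\<close> these are the singular values of \<open>X\<close>.
\<close>

definition singular_values :: "real^'m^'n \<Rightarrow> real list" where
  "singular_values X =
     rev (sorted_list_of_multiset (image_mset sqrt (proots (charpoly (X ** transpose X)))))"

text \<open>Numbered from 1.\<close>

definition singular_value :: "nat \<Rightarrow> real^'m^'n \<Rightarrow> real" where
  "singular_value i X = singular_values X ! (i - 1)"

definition nuclear_norm :: "real^'m^'n \<Rightarrow> real" where
  "nuclear_norm (X :: real^'m^'n) = (\<Sum>i = 1..CARD('n). singular_value i X)"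

definition ky_fan_norm :: "nat \<Rightarrow> real^'m^'n \<Rightarrow> real" where
  "ky_fan_norm r X = (\<Sum>i = 1..r. singular_value i X)"


subsection \<open>Distance, calmness, subregularity\<close>

text \<open>Unlike \<open>infdist\<close>, this is \<open>\<infinity>\<close> on the empty set.\<close>

definition edist_set :: "'a::metric_space \<Rightarrow> 'a set \<Rightarrow> ereal" where
  "edist_set x C = (INF c\<in>C. ereal (dist x c))"

text \<open>Multifunctions are set-valued functions; \<open>Z\<close> is the Euclidean space in which \<open>z\<close> varies.\<close>

definition calm_at ::
  "'z::euclidean_space set \<Rightarrow> ('y::euclidean_space \<Rightarrow> 'z set) \<Rightarrow> 'y \<Rightarrow> 'z \<Rightarrow> bool" where
  "calm_at Z M yb zb \<longleftrightarrow>
     zb \<in> M yb \<and>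
     (\<exists>\<gamma>\<ge>0. \<exists>\<epsilon>>0. \<exists>\<delta>>0. \<forall>y. norm (y - yb) \<le> \<epsilon> \<longrightarrow>
        M y \<inter> (cball zb \<delta> \<inter> Z) \<subseteq>
          {w + (\<gamma> * norm (y - yb)) *\<^sub>R b | w b. w \<in> M yb \<and> b \<in> cball 0 1 \<inter> Z})"

text \<open>
  Whether \<open>0 * \<infinity>\<close> is \<open>0\<close> (as in \<open>ereal\<close>) or \<open>\<infinity>\<close> does not matter below: a \<open>\<kappa>\<close> valid for either
  convention may be replaced by \<open>\<kappa> + 1\<close>, which is valid for both.
\<close>

definition subregular_at ::
  "'z::euclidean_space set \<Rightarrow> ('z \<Rightarrow> 'y::euclidean_space set) \<Rightarrow> 'z \<Rightarrow> 'y \<Rightarrow> bool" where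
  "subregular_at Z F zb yb \<longleftrightarrow>
     yb \<in> F zb \<and>
     (\<exists>\<kappa>\<ge>0. \<exists>\<epsilon>>0. \<forall>z\<in>cball zb \<epsilon> \<inter> Z.
        edist_set z {z'\<in>Z. yb \<in> F z'} \<le> ereal \<kappa> * edist_set yb (F z))"


subsection \<open>Normal cones\<close>

text \<open>At an isolated point of \<open>S\<close> the limit superior is \<open>- \<infinity>\<close>, and every \<open>v \<in> V\<close> is a normal.\<close>

definition frechet_normal_cone :: "'a::euclidean_space set \<Rightarrow> 'a set \<Rightarrow> 'a \<Rightarrow> 'a set" where
  "frechet_normal_cone V S xb =
     {v\<in>V. Limsup (at xb within S) (\<lambda>x. ereal (inner v (x - xb) / norm (x - xb))) \<le> 0}"

definition limiting_normal_cone :: "'a::euclidean_space set \<Rightarrow> 'a set \<Rightarrow> 'a \<Rightarrow> 'a set" where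
  "limiting_normal_cone V S xb =
     {v\<in>V. \<exists>x u. (\<forall>k::nat. x k \<in> S \<and> u k \<in> frechet_normal_cone V S (x k)) \<and>
                 x \<longlonglongrightarrow> xb \<and> u \<longlonglongrightarrow> v}"


subsection \<open>The rank-constrained sets and the associated multifunctions\<close>

definition Lambda_set :: "(real^'m^'n) set \<Rightarrow> nat \<Rightarrow> (real^'m^'n) set" where
  "Lambda_set V r = {X\<in>V. rank X \<le> r}"

definition Gamma_set :: "(real^'m^'n) set \<Rightarrow> nat \<Rightarrow> (real^'m^'n) set" where
  "Gamma_set \<Omega> r = {X\<in>\<Omega>. rank X \<le> r}"

definition S_map :: "(real^'m^'n) set \<Rightarrow> nat \<Rightarrow> real \<Rightarrow> (real^'m^'n) set" where
  "S_map \<Omega> r \<tau> = {X\<in>\<Omega>. nuclear_norm X - ky_fan_norm r X = \<tau>}"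

definition F_map ::
  "(real^'m^'n) set \<Rightarrow> (real^'m^'n) set \<Rightarrow> nat \<Rightarrow> (real^'m^'n) \<times> (real^'m^'n) \<Rightarrow> (real^'m^'n) set" where
  "F_map V \<Omega> r = (\<lambda>(X, Y). if (X, Y) \<in> \<Omega> \<times> Lambda_set V r then {X - Y} else {})"

end

theory Submission
  imports Defs
begin

text \<open>
  All the conditions compare the distance to \<open>\<Gamma>\<^sub>r = \<Omega> \<inter> \<Lambda>\<^sub>r\<close> with how far a point violates one of
  the two constraints, and they agree because the residual \<open>f(X) = nuclear_norm X - ky_fan_norm r X\<close>, the sum of
  the singular values beyond the \<open>r\<close>-th, is comparable to the distance to \<open>\<Lambda>\<^sub>r\<close> on both sides. Every
  \<open>X\<close> has a matrix of rank at most \<open>r\<close> within distance \<open>f(X)\<close>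
  (\<open>rectangular_low_rank_approximation\<close>, \<open>symmetric_low_rank_approximation\<close>), and
  \<open>f(X) \<le> n * norm (X - Y)\<close> for every \<open>Y\<close> of rank at most \<open>r\<close> (\<open>singular_value_tail_le\<close>). These
  constants are cruder than the exact Eckart-Young distance, but calmness and its relatives are
  insensitive to constants. Both bounds come from the spectral theorem for real symmetric matrices, which
  also identifies the singular values, defined as roots of a characteristic polynomial, with
  the eigenvalue data of an orthonormal basis.

  The locale \<open>constraint_residual\<close> isolates this comparability in an arbitrary Euclidean space, where
  calmness, linear regularity and subregularity are each shown equivalent to one
  local error bound, \<open>error_bound_at\<close>: near \<open>xb\<close>, a point \<open>x\<close> of \<open>\<Omega>\<close> has a point of \<open>\<Gamma>\<close>
  within a fixed multiple of \<open>f x\<close>.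

  For the normal cone condition, suppose that the error bound fails. Then there are pairs in
  \<open>\<Omega> \<times> \<Lambda>\<close> near \<open>(xb, xb)\<close> that are much closer to each other than to \<open>\<Gamma>\<close>. Minimising the distance between
  the two components, with a quadratic penalty, produces nearby pairs with Frechet normals
  that are almost opposite unit vectors (\<open>almost_opposite_normals\<close>). A limit of these vectors contradicts
  the triviality of the intersection of the limiting normal cones.
\<close>

section \<open>Distances and residuals\<close>

lemma edist_set_eq_infdist:
  assumes "C \<noteq> {}"
  shows "edist_set x C = ereal (infdist x C)"
proof -
  have "bdd_below (dist x ` C)" by (rule bdd_belowI2[of _ 0]) simp
  then show ?thesis
    using assms by (simp add: edist_set_def infdist_def ereal_Inf' image_image)
qed

lemma edist_set_le: "c \<in> C \<Longrightarrow> edist_set x C \<le> ereal (dist x c)"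
  unfolding edist_set_def by (rule INF_lower)

text \<open>
  The common core to which every condition of the theorem is reduced. It involves only points of
  \<open>\<Omega>\<close>, where the residual \<open>f\<close> is the sole obstruction to lying in \<open>\<Gamma>\<close>; asking for a witness
  \<open>w\<close> instead of bounding an infimum avoids any convention for the distance to an empty set.
\<close>

definition error_bound_at :: "'a::real_normed_vector set \<Rightarrow> 'a set \<Rightarrow> ('a \<Rightarrow> real) \<Rightarrow> 'a \<Rightarrow> bool" where
  "error_bound_at \<Omega> \<Gamma> f xb \<longleftrightarrow>
     (\<exists>\<gamma>\<ge>0. \<exists>\<delta>>0. \<forall>x\<in>\<Omega>. norm (x - xb) \<le> \<delta> \<longrightarrow> (\<exists>w\<in>\<Gamma>. norm (x - w) \<le> \<gamma> * f x))"

text \<open>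
  The constraint \<open>x \<in> \<Lambda>\<close> is measured by a residual \<open>f\<close> that is two-sidedly comparable to the distance
  to \<open>\<Lambda>\<close>. The lower comparison is stated through an actual point of \<open>\<Lambda>\<close>, so that \<open>\<Lambda>\<close> is the zero
  set of \<open>f\<close> in \<open>V\<close> and its closedness follows instead of being assumed.
\<close>

locale constraint_residual =
  fixes V \<Omega> \<Lambda> :: "'a::euclidean_space set" and f :: "'a \<Rightarrow> real" and C :: real and xb :: 'a
  assumes subspace_V: "subspace V"
    and closed_Omega: "closed \<Omega>" and Omega_sub: "\<Omega> \<subseteq> V" and Lambda_sub: "\<Lambda> \<subseteq> V"
    and residual_attained: "x \<in> V \<Longrightarrow> \<exists>y\<in>\<Lambda>. norm (x - y) \<le> f x"
    and residual_le: "x \<in> V \<Longrightarrow> y \<in> \<Lambda> \<Longrightarrow> f x \<le> C * norm (x - y)"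
    and C_nonneg: "0 \<le> C"
    and xb_Omega: "xb \<in> \<Omega>" and xb_Lambda: "xb \<in> \<Lambda>"
begin

lemma residual_nonneg: "x \<in> V \<Longrightarrow> 0 \<le> f x"
  using residual_attained norm_ge_zero order_trans by blast

lemma residual_eq_0_iff: "x \<in> V \<Longrightarrow> f x = 0 \<longleftrightarrow> x \<in> \<Lambda>"
proof
  assume "x \<in> V" "f x = 0"
  then show "x \<in> \<Lambda>" using residual_attained[of x] by auto
next
  assume "x \<in> V" "x \<in> \<Lambda>"
  then show "f x = 0" using residual_le[of x x] residual_nonneg[of x] by auto
qed

text \<open>
  At a limit point of \<open>\<Lambda>\<close> the upper comparison forces the residual to vanish, and the lower one then
  puts the point into \<open>\<Lambda>\<close>.
\<close>

lemma closed_Lambda: "closed \<Lambda>"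
proof -
  have "x \<in> \<Lambda>" if x: "x \<in> closure \<Lambda>" for x
  proof -
    have xV: "x \<in> V"
      using x Lambda_sub closed_subspace[OF subspace_V] by (meson closure_minimal subsetD)
    have "f x \<le> 0 + e" if e: "e > 0" for e
    proof -
      have "e / (C + 1) > 0" using e C_nonneg by simp
      then obtain y where y: "y \<in> \<Lambda>" "dist y x < e / (C + 1)"
        using x unfolding closure_approachable by blast
      have "f x \<le> (C + 1) * norm (x - y)"
        using residual_le[OF xV y(1)] norm_ge_zero[of "x - y"] unfolding distrib_right by linarith
      also have "\<dots> \<le> e"
        using y(2) C_nonneg by (simp add: dist_norm norm_minus_commute field_simps)
      finally show ?thesis by simp
    qed
    then have "f x \<le> 0" by (rule field_le_epsilon)
    then show ?thesis using residual_nonneg[OF xV] residual_eq_0_iff[OF xV] by auto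
  qed
  then show ?thesis by (metis closure_subset closure_eq subsetI subset_antisym)
qed

abbreviation "\<Gamma> \<equiv> \<Omega> \<inter> \<Lambda>"

lemma xb_Gamma: "xb \<in> \<Gamma>" using xb_Omega xb_Lambda by simp

lemma closed_Gamma: "closed \<Gamma>" using closed_Omega closed_Lambda by blast

lemma Gamma_alt: "{x\<in>\<Omega>. f x = 0} = \<Gamma>"
  using residual_eq_0_iff Omega_sub by auto

lemma nearest_Gamma: obtains w where "w \<in> \<Gamma>" "infdist x \<Gamma> = norm (x - w)"
  using infdist_attains_inf[OF closed_Gamma, of x] xb_Gamma by (metis dist_norm empty_iff)

text \<open>
  Calmness restricts to small perturbations \<open>\<tau>\<close>. That costs nothing, since \<open>f x \<le> C * norm (x - xb)\<close>
  makes the residual of every nearby point small.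
\<close>

lemma calm_iff_error_bound:
  "calm_at V (\<lambda>\<tau>. {x\<in>\<Omega>. f x = \<tau>}) 0 xb \<longleftrightarrow> error_bound_at \<Omega> \<Gamma> f xb" (is "?calm \<longleftrightarrow> ?eb")
proof
  assume ?calm
  then obtain \<gamma> \<epsilon> \<delta> where *: "\<gamma> \<ge> 0" "\<epsilon> > 0" "\<delta> > 0"
    and sub: "\<And>\<tau>. \<bar>\<tau>\<bar> \<le> \<epsilon> \<Longrightarrow> {x\<in>\<Omega>. f x = \<tau>} \<inter> (cball xb \<delta> \<inter> V) \<subseteq>
        {w + (\<gamma> * \<bar>\<tau>\<bar>) *\<^sub>R b | w b. w \<in> \<Gamma> \<and> b \<in> cball 0 1 \<inter> V}"
    unfolding calm_at_def Gamma_alt by auto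
  define \<delta>' where "\<delta>' = min \<delta> (\<epsilon> / (C + 1))"
  have "\<exists>w\<in>\<Gamma>. norm (x - w) \<le> \<gamma> * f x" if x: "x \<in> \<Omega>" "norm (x - xb) \<le> \<delta>'" for x
  proof -
    have xV: "x \<in> V" using x Omega_sub by auto
    have "f x \<le> (C + 1) * norm (x - xb)"
      using residual_le[OF xV xb_Lambda] norm_ge_zero[of "x - xb"] unfolding distrib_right by linarith
    also have "\<dots> \<le> \<epsilon>"
      using x(2) C_nonneg by (simp add: \<delta>'_def field_simps)
    finally have "\<bar>f x\<bar> \<le> \<epsilon>" using residual_nonneg[OF xV] by simp
    from sub[OF this] x xV obtain w b where wb: "w \<in> \<Gamma>" "b \<in> cball 0 1" "x = w + (\<gamma> * \<bar>f x\<bar>) *\<^sub>R b"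
      by (force simp: \<delta>'_def dist_norm norm_minus_commute)
    then have "norm (x - w) = \<gamma> * f x * norm b"
      using residual_nonneg[OF xV] * by (metis add_diff_cancel_left' norm_scaleR abs_mult abs_of_nonneg abs_abs)
    also have "\<dots> \<le> \<gamma> * f x * 1"
      using wb(2) * residual_nonneg[OF xV] by (intro mult_left_mono) auto
    finally show ?thesis using wb(1) by auto
  qed
  moreover have "\<delta>' > 0" using * C_nonneg by (simp add: \<delta>'_def)
  ultimately show ?eb unfolding error_bound_at_def using * by blast
next
  assume ?eb
  then obtain \<gamma> \<delta> where *: "\<gamma> \<ge> 0" "\<delta> > 0"
    and eb: "\<And>x. x\<in>\<Omega> \<Longrightarrow> norm (x - xb) \<le> \<delta> \<Longrightarrow> \<exists>w\<in>\<Gamma>. norm (x - w) \<le> \<gamma> * f x"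
    unfolding error_bound_at_def by blast
  have "\<exists>w b. x = w + (\<gamma> * \<bar>f x\<bar>) *\<^sub>R b \<and> w \<in> \<Gamma> \<and> b \<in> cball 0 1 \<inter> V"
    if x: "x \<in> \<Omega>" "x \<in> cball xb \<delta>" for x
  proof -
    have xV: "x \<in> V" using x Omega_sub by auto
    obtain w where w: "w \<in> \<Gamma>" "norm (x - w) \<le> \<gamma> * f x"
      using eb x by (metis dist_commute dist_norm mem_cball)
    define t where "t = \<gamma> * f x"
    have t: "t \<ge> 0" "norm (x - w) \<le> t"
      using *(1) residual_nonneg[OF xV] w(2) by (simp_all add: t_def)
    define b where "b = inverse t *\<^sub>R (x - w)"
    have "b \<in> V" unfolding b_def
      using w xV Omega_sub subspace_V by (auto intro!: subspace_scale subspace_diff)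
    moreover have "norm b \<le> 1"
      using t by (cases "t = 0") (auto simp: b_def inverse_eq_divide divide_le_eq_1)
    moreover have "x = w + t *\<^sub>R b"
      using t by (cases "t = 0") (auto simp: b_def)
    moreover have "\<gamma> * \<bar>f x\<bar> = t" using residual_nonneg[OF xV] by (simp add: t_def)
    ultimately show ?thesis using w(1) by auto
  qed
  note decomposition = this
  have "{x\<in>\<Omega>. f x = \<tau>} \<inter> (cball xb \<delta> \<inter> V) \<subseteq>
      {w + (\<gamma> * norm (\<tau> - 0)) *\<^sub>R b | w b. w \<in> \<Gamma> \<and> b \<in> cball 0 1 \<inter> V}" for \<tau>
    using decomposition by auto
  moreover have "xb \<in> {x\<in>\<Omega>. f x = 0}" unfolding Gamma_alt by (rule xb_Gamma)
  ultimately show ?calm unfolding calm_at_def Gamma_alt using * zero_less_one by blast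
qed

lemma edist_Gamma: "edist_set x \<Gamma> = ereal (infdist x \<Gamma>)"
  and edist_Omega: "edist_set x \<Omega> = ereal (infdist x \<Omega>)"
  and edist_Lambda: "edist_set x \<Lambda> = ereal (infdist x \<Lambda>)"
  using xb_Omega xb_Lambda by (auto intro!: edist_set_eq_infdist)

text \<open>
  Linear regularity speaks about arbitrary points of \<open>V\<close>; projecting such a point onto \<open>\<Omega>\<close> first
  moves it by its distance to \<open>\<Omega>\<close>, at most doubles its distance to \<open>xb\<close> and changes the distance to
  \<open>\<Lambda>\<close> by a controlled amount, so the error bound at the projection is enough.
\<close>

lemma linear_regularity_iff_error_bound:
  "(\<exists>\<gamma>\<ge>0. \<exists>\<delta>>0. \<forall>x\<in>V. norm (x - xb) \<le> \<delta> \<longrightarrow>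
      edist_set x \<Gamma> \<le> ereal \<gamma> * (edist_set x \<Omega> + edist_set x \<Lambda>)) \<longleftrightarrow> error_bound_at \<Omega> \<Gamma> f xb"
  (is "?lr \<longleftrightarrow> ?eb")
proof
  assume ?lr
  then obtain \<gamma> \<delta> where *: "\<gamma> \<ge> 0" "\<delta> > 0"
    and lr: "\<And>x. x\<in>V \<Longrightarrow> norm (x - xb) \<le> \<delta> \<Longrightarrow> infdist x \<Gamma> \<le> \<gamma> * (infdist x \<Omega> + infdist x \<Lambda>)"
    unfolding edist_Gamma edist_Omega edist_Lambda by auto
  have "\<exists>w\<in>\<Gamma>. norm (x - w) \<le> \<gamma> * f x" if x: "x \<in> \<Omega>" "norm (x - xb) \<le> \<delta>" for x
  proof -
    have xV: "x \<in> V" using x Omega_sub by auto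
    obtain y where "y \<in> \<Lambda>" "norm (x - y) \<le> f x" using residual_attained[OF xV] by blast
    then have "infdist x \<Lambda> \<le> f x" by (metis infdist_le2 dist_norm)
    moreover obtain w where "w \<in> \<Gamma>" "infdist x \<Gamma> = norm (x - w)" by (rule nearest_Gamma)
    ultimately show ?thesis using lr[OF xV x(2)] x(1) *(1)
      by (metis add_0 infdist_zero mult_left_mono order_trans)
  qed
  then show ?eb unfolding error_bound_at_def using * by blast
next
  assume ?eb
  then obtain \<gamma> \<delta> where *: "\<gamma> \<ge> 0" "\<delta> > 0"
    and eb: "\<And>x. x\<in>\<Omega> \<Longrightarrow> norm (x - xb) \<le> \<delta> \<Longrightarrow> \<exists>w\<in>\<Gamma>. norm (x - w) \<le> \<gamma> * f x"
    unfolding error_bound_at_def by blast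
  have "infdist x \<Gamma> \<le> (\<gamma> * C + 1) * (infdist x \<Omega> + infdist x \<Lambda>)"
    if x: "x \<in> V" "norm (x - xb) \<le> \<delta> / 2" for x
  proof -
    obtain p where p: "p \<in> \<Omega>" "infdist x \<Omega> = norm (x - p)"
      using infdist_attains_inf[OF closed_Omega, of x] xb_Omega by (metis dist_norm empty_iff)
    obtain y where y: "y \<in> \<Lambda>" "infdist x \<Lambda> = norm (x - y)"
      using infdist_attains_inf[OF closed_Lambda, of x] xb_Lambda by (metis dist_norm empty_iff)
    \<comment> \<open>The radius \<open>\<delta> / 2\<close> pays for the projection: \<open>p\<close> is at most twice as far from \<open>xb\<close> as \<open>x\<close>.\<close>
    have "norm (x - p) \<le> norm (x - xb)"
      using p(2) xb_Omega by (metis infdist_le dist_norm)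
    then have "norm (p - xb) \<le> \<delta>"
      using x(2) norm_triangle_ineq[of "p - x" "x - xb"] by (simp add: norm_minus_commute)
    then obtain w where w: "w \<in> \<Gamma>" "norm (p - w) \<le> \<gamma> * f p" using eb p(1) by blast
    have "f p \<le> C * norm (p - y)" using residual_le p(1) y(1) Omega_sub by blast
    also have "\<dots> \<le> C * (norm (x - p) + norm (x - y))"
      using norm_triangle_ineq[of "p - x" "x - y"] C_nonneg
      by (intro mult_left_mono) (auto simp: norm_minus_commute)
    finally have "\<gamma> * f p \<le> \<gamma> * C * (norm (x - p) + norm (x - y))"
      using *(1) by (simp add: mult_left_mono mult.assoc)
    moreover have "infdist x \<Gamma> \<le> norm (x - w)" using w(1) by (metis infdist_le dist_norm)
    moreover have "norm (x - w) \<le> norm (x - p) + norm (p - w)"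
      using norm_triangle_ineq[of "x - p" "p - w"] by simp
    ultimately have "infdist x \<Gamma> \<le> norm (x - p) + \<gamma> * C * (norm (x - p) + norm (x - y))"
      using w(2) by linarith
    moreover define s where "s = norm (x - p) + norm (x - y)"
    moreover have "norm (x - p) \<le> s" by (simp add: s_def)
    moreover have "(\<gamma> * C + 1) * s = \<gamma> * C * s + s" by (simp add: distrib_right)
    ultimately show ?thesis unfolding p(2) y(2) s_def[symmetric] by simp
  qed
  then show ?lr unfolding edist_Gamma edist_Omega edist_Lambda using * C_nonneg
    by (intro exI[of _ "\<gamma> * C + 1"] conjI exI[of _ "\<delta> / 2"]) auto
qed

text \<open>
  The solution set of the coupling map is the diagonal of \<open>\<Gamma>\<close>. Subregularity is tested at \<open>(x, y)\<close>
  with \<open>y\<close> a point of \<open>\<Lambda>\<close> within \<open>f x\<close> of \<open>x\<close>; conversely, a point of \<open>\<Gamma>\<close> near \<open>x\<close> is also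
  near \<open>y\<close> by the triangle inequality.
\<close>

lemma subregular_iff_error_bound:
  "subregular_at (V \<times> V) (\<lambda>(x, y). if (x, y) \<in> \<Omega> \<times> \<Lambda> then {x - y} else {}) (xb, xb) 0
     \<longleftrightarrow> error_bound_at \<Omega> \<Gamma> f xb" (is "subregular_at _ ?F _ _ \<longleftrightarrow> ?eb")
proof -
  have inv: "{z\<in>V \<times> V. 0 \<in> ?F z} = (\<lambda>w. (w, w)) ` \<Gamma>"
    using Omega_sub by (auto split: if_splits)
  have F0: "0 \<in> ?F (xb, xb)" using xb_Omega xb_Lambda by simp
  show ?thesis
  proof
    assume "subregular_at (V \<times> V) ?F (xb, xb) 0"
    then obtain \<kappa> \<epsilon> where *: "\<kappa> \<ge> 0" "\<epsilon> > 0"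
      and sr: "\<And>z. z \<in> cball (xb, xb) \<epsilon> \<inter> V \<times> V \<Longrightarrow>
        edist_set z ((\<lambda>w. (w, w)) ` \<Gamma>) \<le> ereal \<kappa> * edist_set 0 (?F z)"
      unfolding subregular_at_def inv by blast
    \<comment> \<open>With \<open>norm (x - y) \<le> C * norm (x - xb)\<close> the pair \<open>(x, y)\<close> is within \<open>(C + 2) * norm (x - xb)\<close> of \<open>(xb, xb)\<close>.\<close>
    define \<delta> where "\<delta> = \<epsilon> / (C + 2)"
    have \<delta>: "\<delta> > 0" using * C_nonneg by (simp add: \<delta>_def)
    have "\<exists>w\<in>\<Gamma>. norm (x - w) \<le> \<kappa> * f x" if x: "x \<in> \<Omega>" "norm (x - xb) \<le> \<delta>" for x
    proof -
      have xV: "x \<in> V" using x Omega_sub by auto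
      obtain y where y: "y \<in> \<Lambda>" "norm (x - y) \<le> f x" using residual_attained[OF xV] by blast
      have "dist (x, y) (xb, xb) \<le> dist x xb + dist y xb"
        by (simp add: dist_Pair_Pair sqrt_sum_squares_le_sum)
      also have "\<dots> \<le> norm (x - xb) + (norm (x - y) + norm (x - xb))"
        using norm_triangle_ineq[of "y - x" "x - xb"] by (simp add: dist_norm norm_minus_commute)
      also have "\<dots> \<le> norm (x - xb) + (C * norm (x - xb) + norm (x - xb))"
        using y(2) residual_le[OF xV xb_Lambda] by simp
      also have "\<dots> = (C + 2) * norm (x - xb)" by (simp add: algebra_simps)
      also have "\<dots> \<le> \<epsilon>" using x(2) C_nonneg by (simp add: \<delta>_def field_simps)
      finally have "(x, y) \<in> cball (xb, xb) \<epsilon> \<inter> V \<times> V"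
        using xV y(1) Lambda_sub by (auto simp: dist_commute)
      from sr[OF this] have "edist_set (x, y) ((\<lambda>w. (w, w)) ` \<Gamma>) \<le> ereal (\<kappa> * norm (x - y))"
        using x(1) y(1) by (simp add: edist_set_def norm_minus_commute)
      moreover have "edist_set x \<Gamma> \<le> edist_set (x, y) ((\<lambda>w. (w, w)) ` \<Gamma>)"
        unfolding edist_set_def image_image
        by (intro INF_mono) (auto intro!: bexI simp: dist_Pair_Pair)
      moreover obtain w where w: "w \<in> \<Gamma>" "infdist x \<Gamma> = norm (x - w)" by (rule nearest_Gamma)
      ultimately have "ereal (norm (x - w)) \<le> ereal (\<kappa> * norm (x - y))"
        unfolding edist_Gamma by (metis order_trans)
      also have "\<dots> \<le> ereal (\<kappa> * f x)" using y(2) *(1) by (simp add: mult_left_mono)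
      finally show ?thesis using w(1) by auto
    qed
    then show ?eb unfolding error_bound_at_def using * \<delta> by blast
  next
    assume ?eb
    then obtain \<gamma> \<delta> where *: "\<gamma> \<ge> 0" "\<delta> > 0"
      and eb: "\<And>x. x\<in>\<Omega> \<Longrightarrow> norm (x - xb) \<le> \<delta> \<Longrightarrow> \<exists>w\<in>\<Gamma>. norm (x - w) \<le> \<gamma> * f x"
      unfolding error_bound_at_def by blast
    \<comment> \<open>The summand 1 also makes \<open>\<kappa>\<close> positive, so that \<open>\<kappa> * \<infinity> = \<infinity>\<close> at pairs outside \<open>\<Omega> \<times> \<Lambda>\<close>.\<close>
    define \<kappa> where "\<kappa> = 2 * \<gamma> * C + 1"
    have \<kappa>: "\<kappa> > 0" using * C_nonneg by (simp add: \<kappa>_def add_nonneg_pos)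
    have "edist_set z ((\<lambda>w. (w, w)) ` \<Gamma>) \<le> ereal \<kappa> * edist_set 0 (?F z)"
      if z: "z \<in> cball (xb, xb) \<delta> \<inter> V \<times> V" for z
    proof -
      obtain x y where xy: "z = (x, y)" by force
      show ?thesis
      proof (cases "x \<in> \<Omega> \<and> y \<in> \<Lambda>")
        case False
        then have "?F z = {}" by (auto simp: xy)
        then show ?thesis using \<kappa> by (simp add: edist_set_def top_ereal_def)
      next
        case True
        have "dist x xb \<le> dist (x, y) (xb, xb)" by (simp add: dist_Pair_Pair)
        also have "\<dots> \<le> \<delta>" using z by (simp add: xy dist_commute)
        finally obtain w where w: "w \<in> \<Gamma>" "norm (x - w) \<le> \<gamma> * f x"
          using eb True by (auto simp: dist_norm)
        have "\<gamma> * f x \<le> \<gamma> * C * norm (x - y)"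
          using residual_le[of x y] True Omega_sub *(1) by (auto simp: mult.assoc intro!: mult_left_mono)
        moreover have "norm (y - w) \<le> norm (x - y) + norm (x - w)"
          using norm_triangle_ineq[of "y - x" "x - w"] by (simp add: norm_minus_commute)
        moreover have "dist z (w, w) \<le> norm (x - w) + norm (y - w)"
          unfolding xy dist_norm[symmetric] by (simp add: dist_Pair_Pair sqrt_sum_squares_le_sum)
        ultimately have "dist z (w, w) \<le> \<kappa> * norm (x - y)" using w(2) by (simp add: \<kappa>_def algebra_simps)
        then show ?thesis
          using edist_set_le[of "(w, w)" "(\<lambda>w. (w, w)) ` \<Gamma>" z] w(1) True
          by (auto simp: xy edist_set_def norm_minus_commute intro: order_trans)
      qed
    qed
    then show "subregular_at (V \<times> V) ?F (xb, xb) 0"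
      unfolding subregular_at_def inv using F0 * \<kappa>
      by (intro conjI exI[of _ \<kappa>] exI[of _ \<delta>] ballI) auto
  qed
qed

end

section \<open>Normal cones and the error bound\<close>

text \<open>
  Fermat's rule: at a constrained minimum the linear part of \<open>h\<close> cannot decrease to first order along
  the constraint set, which is exactly what the limit superior in the normal cone expresses.
\<close>

lemma minimizer_imp_frechet_normal:
  assumes grad: "GDERIV h x :> g" and min: "\<And>z. z \<in> S \<Longrightarrow> h x \<le> h z" and g: "- g \<in> V"
  shows "- g \<in> frechet_normal_cone V S x"
proof -
  have "Limsup (at x within S) (\<lambda>z. ereal (inner (- g) (z - x) / norm (z - x))) \<le> 0 + ereal e"
    if e: "e > 0" for e
  proof -
    have "(h has_derivative (\<lambda>k. inner k g)) (at x within S)"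
      using grad unfolding gderiv_def by (rule has_derivative_at_withinI)
    then obtain d where d: "d > 0"
      "\<And>z. z \<in> S \<Longrightarrow> norm (z - x) < d \<Longrightarrow> norm (h z - h x - inner (z - x) g) \<le> e * norm (z - x)"
      using e unfolding has_derivative_within_alt by blast
    have "inner (- g) (z - x) / norm (z - x) \<le> e" if z: "z \<in> S" "z \<noteq> x" "norm (z - x) < d" for z
    proof -
      have "inner (- g) (z - x) \<le> e * norm (z - x)"
        using d(2)[OF z(1,3)] min[OF z(1)] by (simp add: inner_commute)
      then show ?thesis using z(2) by (simp add: field_simps)
    qed
    then have "\<forall>\<^sub>F z in at x within S. ereal (inner (- g) (z - x) / norm (z - x)) \<le> ereal e"
      unfolding eventually_at using d(1) by (auto simp: dist_norm intro!: exI[of _ d])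
    then show ?thesis by (simp add: Limsup_bounded)
  qed
  then have "Limsup (at x within S) (\<lambda>z. ereal (inner (- g) (z - x) / norm (z - x))) \<le> 0"
    by (rule ereal_le_epsilon2)
  then show ?thesis using g by (simp add: frechet_normal_cone_def)
qed

lemma GDERIV_norm_plus_square:
  fixes z a b :: "'a::euclidean_space"
  assumes "z \<noteq> a"
  shows "GDERIV (\<lambda>z. norm (z - a) + c * ((norm (z - b))\<^sup>2 + k)) z :> sgn (z - a) + (2 * c) *\<^sub>R (z - b)"
proof -
  have "((\<lambda>z. norm (z - a) + c * (inner (z - b) (z - b) + k)) has_derivative
      (\<lambda>h. inner h (sgn (z - a)) + c * (2 * inner h (z - b)))) (at z)"
    using assms
    by (auto intro!: derivative_eq_intros has_derivative_norm[THEN has_derivative_compose[rotated]]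
        simp: inner_commute algebra_simps)
  then show ?thesis
    unfolding gderiv_def by (simp add: power2_norm_eq_inner inner_add_right mult_ac)
qed

context constraint_residual
begin

text \<open>
  The variational step. Without an error bound some \<open>x0\<close> near \<open>xb\<close> in \<open>\<Omega>\<close> lies much closer to
  some \<open>y0\<close> in \<open>\<Lambda>\<close> than to \<open>\<Gamma>\<close>. Minimising \<open>norm (x - y)\<close> plus a quadratic penalty around
  \<open>(x0, y0)\<close> over \<open>\<Omega> \<times> \<Lambda>\<close> gives a pair that cannot meet, because \<open>\<Gamma>\<close> is too far away.
  Hence the norm is differentiable there with a unit gradient \<open>e\<close>, and Fermat's rule in each variable
  yields normals that equal \<open>- e\<close> and \<open>e\<close> up to the small gradient of the penalty. The smooth penalty,
  unlike the norm perturbation of Ekeland's principle, gives genuine Frechet normals instead of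
  approximate ones.
\<close>

lemma almost_opposite_normals:
  assumes no_eb: "\<not> error_bound_at \<Omega> \<Gamma> f xb" and \<eta>: "\<eta> > 0"
  shows "\<exists>x y e p q. x \<in> \<Omega> \<and> y \<in> \<Lambda> \<and> norm (x - xb) \<le> \<eta> \<and> norm (y - xb) \<le> \<eta> \<and>
    e \<in> V \<and> norm e = 1 \<and> norm p \<le> \<eta> \<and> norm q \<le> \<eta> \<and>
    - (e + p) \<in> frechet_normal_cone V \<Omega> x \<and> e - q \<in> frechet_normal_cone V \<Lambda> y"
proof -
  \<comment> \<open>With \<open>c\<close> as below the penalty has gradient at most \<open>8 * \<epsilon> / d\<close>, which \<open>8 / K\<close> bounds; the summand 1 gives \<open>\<epsilon> \<le> d\<close>.\<close>
  define K where "K = 8 / \<eta> + 1"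
  have K: "K \<ge> 1" "8 / K \<le> \<eta>" using \<eta> by (auto simp: K_def field_simps)
  have "\<eta> / 3 > 0" using \<eta> by simp
  then obtain x0 where x0: "x0 \<in> \<Omega>" "norm (x0 - xb) \<le> \<eta> / 3" "\<And>w. w \<in> \<Gamma> \<Longrightarrow> norm (x0 - w) > K * f x0"
    using no_eb K(1) unfolding error_bound_at_def by (smt (verit) zero_le_one)
  have x0V: "x0 \<in> V" using x0 Omega_sub by auto
  obtain y0 where y0: "y0 \<in> \<Lambda>" "norm (x0 - y0) \<le> f x0" using residual_attained[OF x0V] by blast
  have y0V: "y0 \<in> V" using y0 Lambda_sub by auto
  define \<epsilon> where "\<epsilon> = norm (x0 - y0)"
  define d where "d = infdist x0 \<Gamma>"
  obtain w0 where w0: "w0 \<in> \<Gamma>" "d = norm (x0 - w0)" unfolding d_def by (rule nearest_Gamma)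
  have d_le: "d \<le> norm (x0 - w)" if "w \<in> \<Gamma>" for w
    unfolding d_def using that by (metis infdist_le dist_norm)
  have Kd: "K * \<epsilon> < d"
    using x0(3)[OF w0(1)] w0(2) y0(2) K(1) unfolding \<epsilon>_def
    by (smt (verit) mult_left_mono)
  have "x0 \<notin> \<Gamma>" using x0(3)[of x0] K(1) residual_nonneg[OF x0V] by (auto simp: mult_less_0_iff)
  then have \<epsilon>: "\<epsilon> > 0" using x0(1) y0(1) by (auto simp: \<epsilon>_def)
  have d: "d > 0" using Kd mult_right_mono[OF K(1), of \<epsilon>] \<epsilon> by linarith
  \<comment> \<open>The weight for which a penalty of at most \<open>\<epsilon>\<close> confines both points to radius \<open>d / 4\<close>, well short of \<open>\<Gamma>\<close>.\<close>
  define c where "c = 16 * \<epsilon> / d\<^sup>2"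
  have c: "c > 0" using \<epsilon> d by (simp add: c_def)
  define g where "g = (\<lambda>(x, y). norm (x - y) + c * ((norm (x - x0))\<^sup>2 + (norm (y - y0))\<^sup>2))"
  have g0: "g (x0, y0) = \<epsilon>" by (simp add: g_def \<epsilon>_def)
  have small: "norm (x - x0) \<le> d / 4 \<and> norm (y - y0) \<le> d / 4" if le: "g (x, y) \<le> \<epsilon>" for x y
  proof -
    have "c * ((norm (x - x0))\<^sup>2 + (norm (y - y0))\<^sup>2) \<le> \<epsilon>"
      using le norm_ge_zero[of "x - y"] unfolding g_def prod.case by linarith
    then have "(norm (x - x0))\<^sup>2 + (norm (y - y0))\<^sup>2 \<le> (d / 4)\<^sup>2"
      using \<epsilon> d by (simp add: c_def pos_divide_le_eq mult.commute[of \<epsilon>] power2_eq_square)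
    then have "(norm (x - x0))\<^sup>2 \<le> (d / 4)\<^sup>2" "(norm (y - y0))\<^sup>2 \<le> (d / 4)\<^sup>2"
      by (smt (verit) zero_le_power2)+
    then show ?thesis using d by (auto intro: power2_le_imp_le)
  qed
  \<comment> \<open>At points of \<open>\<Omega> \<times> \<Lambda>\<close> outside \<open>T\<close> the objective exceeds its value at \<open>(x0, y0)\<close>, so a minimiser over the compact \<open>T\<close> is global.\<close>
  define T where "T = (\<Omega> \<times> \<Lambda>) \<inter> (cball x0 (d / 4) \<times> cball y0 (d / 4))"
  have "compact T" unfolding T_def
    by (intro closed_Int_compact closed_Times closed_Omega closed_Lambda compact_Times compact_cball)
  moreover have inT: "(x0, y0) \<in> T" using x0(1) y0(1) d by (simp add: T_def)
  moreover have "continuous_on T g" unfolding g_def case_prod_unfold by (intro continuous_intros)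
  ultimately obtain z where z: "z \<in> T" "\<And>z'. z' \<in> T \<Longrightarrow> g z \<le> g z'"
    using continuous_attains_inf[of T g] by blast
  obtain x y where xy: "z = (x, y)" by force
  have min: "g (x, y) \<le> g (x', y')" if "x' \<in> \<Omega>" "y' \<in> \<Lambda>" for x' y'
  proof (cases "g (x', y') \<le> \<epsilon>")
    case True
    from small[OF this] have "(x', y') \<in> T"
      using that by (simp add: T_def dist_norm norm_minus_commute)
    then show ?thesis using z(2) by (simp add: xy)
  next
    case False
    then show ?thesis using z(2)[OF inT] by (simp add: xy g0)
  qed
  have xO: "x \<in> \<Omega>" and yL: "y \<in> \<Lambda>" and dx: "norm (x - x0) \<le> d / 4" and dy: "norm (y - y0) \<le> d / 4"
    using z(1) by (auto simp: xy T_def dist_norm norm_minus_commute)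
  have xV: "x \<in> V" and yV: "y \<in> V" using xO yL Omega_sub Lambda_sub by auto
  have ne: "x \<noteq> y"
  proof
    assume "x = y"
    then have "d \<le> norm (x0 - x)" using d_le xO yL by simp
    then show False using dx d by (simp add: norm_minus_commute)
  qed
  define e where "e = sgn (x - y)"
  define p where "p = (2 * c) *\<^sub>R (x - x0)"
  define q where "q = (2 * c) *\<^sub>R (y - y0)"
  have eV: "e \<in> V" and pV: "p \<in> V" and qV: "q \<in> V"
    using xV yV x0V y0V subspace_V
    by (auto simp: e_def p_def q_def sgn_div_norm intro!: subspace_scale subspace_diff)
  have pq: "2 * c * t \<le> \<eta>" if "t \<le> d / 4" for t
  proof -
    have "2 * c * t \<le> 2 * c * (d / 4)" using that c by simp
    also have "\<dots> = 8 * (\<epsilon> / d)" using d by (simp add: c_def power2_eq_square)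
    also have "\<dots> \<le> 8 * (1 / K)" using Kd K(1) d by (intro mult_left_mono) (auto simp: field_simps)
    finally show ?thesis using K(2) by simp
  qed
  have np: "norm p \<le> \<eta>" and nq: "norm q \<le> \<eta>" using pq[OF dx] pq[OF dy] c by (auto simp: p_def q_def)
  have "- (e + p) \<in> frechet_normal_cone V \<Omega> x"
    unfolding e_def p_def
  proof (rule minimizer_imp_frechet_normal)
    show "GDERIV (\<lambda>x. g (x, y)) x :> sgn (x - y) + (2 * c) *\<^sub>R (x - x0)"
      unfolding g_def prod.case by (rule GDERIV_norm_plus_square[OF ne])
    show "g (x, y) \<le> g (x', y)" if "x' \<in> \<Omega>" for x' using min that yL by blast
    show "- (sgn (x - y) + (2 * c) *\<^sub>R (x - x0)) \<in> V"
      using eV pV subspace_V unfolding e_def p_def by (intro subspace_neg subspace_add)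
  qed
  moreover have "- (sgn (y - x) + (2 * c) *\<^sub>R (y - y0)) \<in> frechet_normal_cone V \<Lambda> y"
  proof (rule minimizer_imp_frechet_normal)
    show "GDERIV (\<lambda>y. g (x, y)) y :> sgn (y - x) + (2 * c) *\<^sub>R (y - y0)"
      using GDERIV_norm_plus_square[OF ne[symmetric], of c y0 "(norm (x - x0))\<^sup>2"]
      unfolding g_def prod.case by (simp add: norm_minus_commute add.commute)
    show "g (x, y) \<le> g (x, y')" if "y' \<in> \<Lambda>" for y' using min that xO by blast
    have "sgn (y - x) = - e" unfolding e_def by (metis minus_diff_eq sgn_minus)
    then show "- (sgn (y - x) + (2 * c) *\<^sub>R (y - y0)) \<in> V"
      using eV qV subspace_V unfolding q_def by (auto intro!: subspace_neg subspace_add subspace_diff)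
  qed
  moreover have "- (sgn (y - x) + (2 * c) *\<^sub>R (y - y0)) = e - q"
    unfolding e_def q_def by (metis minus_add_distrib minus_diff_eq sgn_minus uminus_add_conv_diff minus_minus)
  moreover have "norm e = 1" using ne by (simp add: e_def norm_sgn)
  moreover have "d \<le> \<eta> / 3" using d_le[OF xb_Gamma] x0(2) by linarith
  moreover have "\<epsilon> \<le> d" using Kd mult_right_mono[OF K(1), of \<epsilon>] \<epsilon> by linarith
  moreover have "norm (x - xb) \<le> norm (x - x0) + norm (x0 - xb)"
    using norm_triangle_ineq[of "x - x0" "x0 - xb"] by simp
  moreover have "norm (y - xb) \<le> norm (y - y0) + \<epsilon> + norm (x0 - xb)"
    using norm_triangle_ineq[of "y - y0" "y0 - xb"] norm_triangle_ineq[of "y0 - x0" "x0 - xb"]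
    by (simp add: \<epsilon>_def norm_minus_commute)
  ultimately have "norm (x - xb) \<le> \<eta>" "norm (y - xb) \<le> \<eta>"
      "- (e + p) \<in> frechet_normal_cone V \<Omega> x" "e - q \<in> frechet_normal_cone V \<Lambda> y" "norm e = 1"
    using x0(2) dx dy \<eta> by (linarith | simp)+
  then show ?thesis using xO yL eV np nq by blast
qed

text \<open>
  As the tolerance in \<open>almost_opposite_normals\<close> tends to zero, a limit of the unit vectors \<open>e\<close> is a
  nonzero element of the intersection that the hypothesis declares trivial.
\<close>

lemma transversality_imp_error_bound:
  assumes trans: "uminus ` limiting_normal_cone V \<Omega> xb \<inter> limiting_normal_cone V \<Lambda> xb = {0}"
  shows "error_bound_at \<Omega> \<Gamma> f xb"
proof (rule ccontr)
  assume no_eb: "\<not> error_bound_at \<Omega> \<Gamma> f xb"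
  have "\<forall>k. \<exists>x y e p q. x \<in> \<Omega> \<and> y \<in> \<Lambda> \<and> norm (x - xb) \<le> inverse (real (Suc k)) \<and>
    norm (y - xb) \<le> inverse (real (Suc k)) \<and>
    e \<in> V \<and> norm e = 1 \<and> norm p \<le> inverse (real (Suc k)) \<and> norm q \<le> inverse (real (Suc k)) \<and>
    - (e + p) \<in> frechet_normal_cone V \<Omega> x \<and> e - q \<in> frechet_normal_cone V \<Lambda> y"
    by (intro allI almost_opposite_normals[OF no_eb]) simp
  then obtain x y e p q where seq: "\<And>k. x k \<in> \<Omega>" "\<And>k. y k \<in> \<Lambda>"
    "\<And>k. norm (x k - xb) \<le> inverse (real (Suc k))" "\<And>k. norm (y k - xb) \<le> inverse (real (Suc k))"
    "\<And>k. e k \<in> V" "\<And>k. norm (e k) = 1"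
    "\<And>k. norm (p k) \<le> inverse (real (Suc k))" "\<And>k. norm (q k) \<le> inverse (real (Suc k))"
    "\<And>k. - (e k + p k) \<in> frechet_normal_cone V \<Omega> (x k)" "\<And>k. e k - q k \<in> frechet_normal_cone V \<Lambda> (y k)"
    by metis
  have null: "a \<longlonglongrightarrow> 0" if "\<And>k. norm (a k) \<le> inverse (real (Suc k))" for a :: "nat \<Rightarrow> 'a"
    using that by (intro Lim_null_comparison[OF _ LIMSEQ_inverse_real_of_nat]) simp
  have "compact (sphere 0 1 \<inter> V)"
    by (intro compact_Int_closed compact_sphere closed_subspace subspace_V)
  moreover have "\<forall>k. e k \<in> sphere 0 1 \<inter> V" using seq by simp
  ultimately obtain l r where l: "l \<in> sphere 0 1 \<inter> V" and r: "strict_mono r" and er: "(e \<circ> r) \<longlonglongrightarrow> l"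
    unfolding compact_def by blast
  have sub: "(\<lambda>k. a (r k)) \<longlonglongrightarrow> L" if "a \<longlonglongrightarrow> L" for a :: "nat \<Rightarrow> 'a" and L
    using LIMSEQ_subseq_LIMSEQ[OF that r] by (simp add: o_def)
  have er': "(\<lambda>k. e (r k)) \<longlonglongrightarrow> l" using er by (simp add: o_def)
  have lims: "(\<lambda>k. x (r k)) \<longlonglongrightarrow> xb" "(\<lambda>k. y (r k)) \<longlonglongrightarrow> xb"
    using null[of "\<lambda>k. x k - xb"] null[of "\<lambda>k. y k - xb"] seq LIM_zero_cancel sub by blast+
  have "(\<lambda>k. - (e (r k) + p (r k))) \<longlonglongrightarrow> - (l + 0)" "(\<lambda>k. e (r k) - q (r k)) \<longlonglongrightarrow> l - 0"
    by (intro tendsto_intros er' sub null seq)+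
  then have xl: "(\<lambda>k. - (e (r k) + p (r k))) \<longlonglongrightarrow> - l" and yl: "(\<lambda>k. e (r k) - q (r k)) \<longlonglongrightarrow> l"
    by simp_all
  have "- l \<in> V" "l \<in> V" using l subspace_neg[OF subspace_V] by auto
  then have "- l \<in> limiting_normal_cone V \<Omega> xb"
    unfolding limiting_normal_cone_def using lims(1) xl seq(1,9)
    by (intro CollectI conjI exI[of _ "\<lambda>k. x (r k)"] exI[of _ "\<lambda>k. - (e (r k) + p (r k))"] allI)
  moreover have "l \<in> limiting_normal_cone V \<Lambda> xb"
    unfolding limiting_normal_cone_def using \<open>l \<in> V\<close> lims(2) yl seq(2,10)
    by (intro CollectI conjI exI[of _ "\<lambda>k. y (r k)"] exI[of _ "\<lambda>k. e (r k) - q (r k)"] allI)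
  ultimately have "l \<in> {0}" using trans by (metis IntI image_eqI minus_minus)
  then show False using l by simp
qed

end

section \<open>The spectral theorem for real symmetric matrices\<close>

definition orthonormal_family :: "('i \<Rightarrow> 'a::real_inner) \<Rightarrow> bool" where
  "orthonormal_family u \<longleftrightarrow> (\<forall>i j. inner (u i) (u j) = (if i = j then 1 else 0))"

lemma symmetric_inner_swap:
  fixes A :: "real^'n^'n"
  assumes "transpose A = A"
  shows "inner (A *v x) y = inner x (A *v y)"
  using dot_lmul_matrix[of x A y] transpose_matrix_vector[of A x] assms by simp

text \<open>
  A maximiser \<open>v\<close> of the Rayleigh quotient on the unit sphere of the subspace is an eigenvector: the form
  \<open>Q\<close> below is nonpositive and vanishes at \<open>v\<close>, while its derivative at \<open>v\<close> in the direction of the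
  defect \<open>w = A v - \<mu> v\<close> is \<open>2 * inner w w\<close>.
\<close>

lemma eigenvector_in_invariant_subspace:
  fixes A :: "real^'n^'n"
  assumes sym: "transpose A = A" and S: "subspace S" "S \<noteq> {0}"
    and inv: "\<And>x. x \<in> S \<Longrightarrow> A *v x \<in> S"
  obtains v \<mu> where "v \<in> S" "norm v = 1" "A *v v = \<mu> *\<^sub>R v"
proof -
  have "compact (sphere 0 1 \<inter> S)"
    by (intro compact_Int_closed compact_sphere closed_subspace S)
  moreover obtain y where y: "y \<in> S" "y \<noteq> 0" using S subspace_0 by blast
  then have "sgn y \<in> sphere 0 1 \<inter> S" using S by (simp add: sgn_div_norm subspace_scale)
  moreover have "continuous_on (sphere 0 1 \<inter> S) (\<lambda>x. inner x (A *v x))"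
    by (intro continuous_intros linear_continuous_on bounded_linear_intros)
  ultimately obtain v where v: "v \<in> S" "norm v = 1"
    and max: "\<And>x. x \<in> S \<Longrightarrow> norm x = 1 \<Longrightarrow> inner x (A *v x) \<le> inner v (A *v v)"
    using continuous_attains_sup[of "sphere 0 1 \<inter> S" "\<lambda>x. inner x (A *v x)"] by (force simp: mem_sphere_0)
  define \<mu> where "\<mu> = inner v (A *v v)"
  define Q where "Q = (\<lambda>x. inner x (A *v x) - \<mu> * inner x x)"
  have Q: "Q x \<le> 0" if x: "x \<in> S" for x
  proof (cases "x = 0")
    case False
    have "inner (sgn x) (A *v sgn x) \<le> \<mu>"
      unfolding \<mu>_def using x False S by (intro max) (auto simp: sgn_div_norm subspace_scale)
    then have "inner x (A *v x) / (norm x)\<^sup>2 \<le> \<mu>"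
      by (simp add: sgn_div_norm matrix_vector_mult_scaleR power2_eq_square divide_inverse mult_ac)
    then show ?thesis
      using False by (simp add: Q_def power2_norm_eq_inner[symmetric] divide_le_eq mult.commute)
  qed (simp add: Q_def)
  define w where "w = A *v v - \<mu> *\<^sub>R v"
  have wS: "w \<in> S" using v inv S by (auto simp: w_def intro!: subspace_diff subspace_scale)
  have "Q v = 0" using v by (simp add: Q_def \<mu>_def power2_norm_eq_inner[symmetric])
  have expand: "Q (v + t *\<^sub>R w) = 2 * t * inner w w + t\<^sup>2 * Q w" for t
  proof -
    have "inner v (A *v w) = inner w (A *v v)"
      using symmetric_inner_swap[OF sym, of v w] by (simp add: inner_commute)
    then have "Q (v + t *\<^sub>R w) = Q v + 2 * t * (inner w (A *v v) - \<mu> * inner w v) + t\<^sup>2 * Q w"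
      unfolding Q_def
      by (simp add: matrix_vector_right_distrib matrix_vector_mult_scaleR inner_add_left inner_add_right
          power2_eq_square algebra_simps inner_commute)
    also have "inner w (A *v v) - \<mu> * inner w v = inner w w"
      by (simp add: w_def inner_diff_left inner_diff_right algebra_simps)
    finally show ?thesis using \<open>Q v = 0\<close> by simp
  qed
  have "inner w w \<le> 0"
  proof (rule ccontr)
    assume "\<not> inner w w \<le> 0"
    then have pos: "inner w w > 0" by (simp only: not_le)
    \<comment> \<open>A step so short that the linear term dominates the quadratic one.\<close>
    define t where "t = inner w w / (\<bar>Q w\<bar> + 1)"
    have t: "t > 0" using pos by (simp add: t_def)
    have "t * \<bar>Q w\<bar> \<le> inner w w" using pos by (simp add: t_def field_simps)
    then have "- inner w w \<le> t * Q w" using t by (smt (verit) mult_minus_right mult_left_mono)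
    then have "t * (inner w w) \<le> t * (2 * inner w w + t * Q w)" using t by (intro mult_left_mono) auto
    also have "\<dots> = Q (v + t *\<^sub>R w)" by (simp add: expand power2_eq_square algebra_simps)
    also have "\<dots> \<le> 0" using v wS S by (intro Q subspace_add subspace_scale)
    finally show False using t pos by (simp add: mult_le_0_iff)
  qed
  then have "w = 0" by (metis inner_ge_zero inner_eq_zero_iff order_antisym)
  then have "A *v v = \<mu> *\<^sub>R v" by (simp add: w_def)
  then show thesis using that v by blast
qed

text \<open>
  The orthogonal complement of a set of eigenvectors of a symmetric matrix is invariant, so it
  contributes a further eigenvector as long as it is nonzero.
\<close>

lemma orthonormal_eigenvectors_of_card:
  fixes A :: "real^'n^'n"
  assumes sym: "transpose A = A"
  shows "k \<le> CARD('n) \<Longrightarrow> \<exists>B. finite B \<and> card B = k \<and> pairwise orthogonal B \<and>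
    (\<forall>b\<in>B. norm b = 1 \<and> (\<exists>\<mu>. A *v b = \<mu> *\<^sub>R b))"
proof (induction k)
  case 0
  then show ?case by (intro exI[of _ "{}"]) simp
next
  case (Suc k)
  then obtain B where B: "finite B" "card B = k" "pairwise orthogonal B"
    "\<And>b. b \<in> B \<Longrightarrow> norm b = 1" "\<And>b. b \<in> B \<Longrightarrow> \<exists>\<mu>. A *v b = \<mu> *\<^sub>R b"
    by auto
  define S where "S = {y. \<forall>x\<in>B. orthogonal x y}"
  have "subspace S" unfolding S_def by (rule subspace_orthogonal_to_vectors)
  moreover have "dim B < DIM(real^'n)" using B Suc.prems dim_le_card'[of B] by simp
  then obtain z where "z \<noteq> 0" "\<And>y. y \<in> span B \<Longrightarrow> orthogonal z y"
    using orthogonal_to_subspace_exists by blast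
  then have "z \<in> S" "z \<noteq> 0" by (auto simp: S_def span_base orthogonal_commute)
  then have "S \<noteq> {0}" by blast
  moreover have "A *v y \<in> S" if y: "y \<in> S" for y
  proof -
    have "inner b (A *v y) = 0" if "b \<in> B" for b
      using B(5)[OF that] y that symmetric_inner_swap[OF sym, of b y]
      by (auto simp: S_def orthogonal_def)
    then show ?thesis by (simp add: S_def orthogonal_def)
  qed
  ultimately obtain v \<mu> where v: "v \<in> S" "norm v = 1" "A *v v = \<mu> *\<^sub>R v"
    using eigenvector_in_invariant_subspace[OF sym] by metis
  have "v \<notin> B" using v by (auto simp: S_def orthogonal_def)
  then have "finite (insert v B) \<and> card (insert v B) = Suc k \<and> pairwise orthogonal (insert v B) \<and>
      (\<forall>b\<in>insert v B. norm b = 1 \<and> (\<exists>\<mu>. A *v b = \<mu> *\<^sub>R b))"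
    using B v by (auto simp: pairwise_insert S_def orthogonal_commute)
  then show ?case by blast
qed

lemma spectral_theorem:
  fixes A :: "real^'n^'n"
  assumes "transpose A = A"
  obtains u :: "'n \<Rightarrow> real^'n" and \<mu> where "orthonormal_family u" "\<And>i. A *v u i = \<mu> i *\<^sub>R u i"
proof -
  obtain B where B: "finite B" "card B = CARD('n)" "pairwise orthogonal B"
    "\<And>b. b \<in> B \<Longrightarrow> norm b = 1" "\<And>b. b \<in> B \<Longrightarrow> \<exists>\<mu>. A *v b = \<mu> *\<^sub>R b"
    using orthonormal_eigenvectors_of_card[OF assms order_refl] by auto
  obtain u :: "'n \<Rightarrow> real^'n" where u: "bij_betw u UNIV B"
    using finite_same_card_bij[of "UNIV :: 'n set" B] B by auto
  have uB: "u i \<in> B" for i using u by (auto simp: bij_betw_def)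
  have "orthonormal_family u"
    unfolding orthonormal_family_def
  proof (intro allI)
    fix i j
    show "inner (u i) (u j) = (if i = j then 1 else 0)"
    proof (cases "i = j")
      case True
      then show ?thesis using B(4)[OF uB, of i] by (simp add: power2_norm_eq_inner[symmetric])
    next
      case False
      then have "u i \<noteq> u j" using u by (auto simp: bij_betw_def inj_on_def)
      then show ?thesis using B(3) uB False by (auto simp: pairwise_def orthogonal_def)
    qed
  qed
  moreover have "\<forall>i. \<exists>\<mu>. A *v u i = \<mu> *\<^sub>R u i" using B(5) uB by blast
  ultimately show thesis using that by metis
qed

text \<open>
  Orthonormality says that the matrix with columns \<open>u i\<close> has its transpose as left inverse; for a square
  matrix it is then a right inverse as well, and this is its entrywise form.
\<close>

lemma orthonormal_family_transpose:
  fixes u :: "'n::finite \<Rightarrow> real^'n"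
  assumes "orthonormal_family u"
  shows "(\<Sum>i\<in>UNIV. u i $ a * u i $ b) = (if a = b then 1 else 0)"
proof -
  define U :: "real^'n^'n" where "U = (\<chi> a i. u i $ a)"
  have "transpose U ** U = mat 1"
    using assms by (simp add: vec_eq_iff U_def transpose_def matrix_matrix_mult_def mat_def
        orthonormal_family_def inner_vec_def)
  then have "U ** transpose U = mat 1" by (simp add: matrix_left_right_inverse)
  then have "(U ** transpose U) $ a $ b = mat 1 $ a $ b" by simp
  then show ?thesis by (simp add: U_def transpose_def matrix_matrix_mult_def mat_def)
qed

section \<open>Singular values through an eigenbasis\<close>

lemma sum_to_const_poly: "[:sum f S:] = (\<Sum>i\<in>S. [:f i:])"
proof (induction S rule: infinite_finite_induct)
  case (insert x F)
  then show ?case by (simp add: insert.IH[symmetric])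
qed simp_all

text \<open>
  Diagonalisation is carried out over the polynomial ring: with the eigenvectors as the constant columns
  of \<open>U\<close>, the characteristic matrix satisfies \<open>X ** U = U ** D\<close>, and \<open>det U\<close> can be cancelled because
  \<open>U\<close> is orthogonal.
\<close>

lemma charpoly_of_orthonormal_eigenbasis:
  fixes A :: "real^'n^'n" and u :: "'n \<Rightarrow> real^'n"
  assumes on: "orthonormal_family u" and eig: "\<And>i. A *v u i = \<mu> i *\<^sub>R u i"
  shows "charpoly A = (\<Prod>i\<in>UNIV. [:- \<mu> i, 1:])"
proof -
  define U :: "real poly^'n^'n" where "U = (\<chi> a i. [:u i $ a:])"
  define D :: "real poly^'n^'n" where "D = (\<chi> i j. if i = j then [:- \<mu> i, 1:] else 0)"
  define X where "X = mat [:0, 1:] - map_matrix (\<lambda>a. [:a:]) A"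
  have "transpose U ** U = mat 1"
    using on by (auto simp: vec_eq_iff U_def transpose_def matrix_matrix_mult_def mat_def
        orthonormal_family_def inner_vec_def sum_to_const_poly[symmetric] one_pCons)
  then have "det (transpose U) * det U = 1" by (metis det_I det_mul)
  then have "det U \<noteq> 0" by auto
  have "X ** U = U ** D"
  proof -
    have "(X ** U) $ a $ j = (U ** D) $ a $ j" for a j
    proof -
      have "(X ** U) $ a $ j =
          (\<Sum>k\<in>UNIV. (if a = k then [:0, 1:] * [:u j $ k:] else 0) - [:A $ a $ k * u j $ k:])"
        unfolding matrix_matrix_mult_def X_def U_def mat_def
        by (auto simp: left_diff_distrib intro!: sum.cong)
      also have "\<dots> = [:0, 1:] * [:u j $ a:] - [:(A *v u j) $ a:]"
        by (simp add: sum_subtractf sum_to_const_poly[symmetric] matrix_vector_mult_def)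
      also have "\<dots> = [:u j $ a:] * [:- \<mu> j, 1:]" by (simp add: eig)
      also have "\<dots> = (U ** D) $ a $ j"
        unfolding matrix_matrix_mult_def U_def D_def by (simp add: if_distrib cong: if_cong)
      finally show ?thesis .
    qed
    then show ?thesis by (simp add: vec_eq_iff)
  qed
  then have "det X * det U = det U * det D" by (metis det_mul)
  then have "det X = det D" using \<open>det U \<noteq> 0\<close> by simp
  also have "\<dots> = (\<Prod>i\<in>UNIV. D $ i $ i)" by (rule det_diagonal) (simp add: D_def)
  finally show ?thesis by (simp add: charpoly_def X_def D_def)
qed

lemma proots_prod_linear: "finite I \<Longrightarrow> proots (\<Prod>i\<in>I. [:- \<mu> i, 1:]) = image_mset \<mu> (mset_set I)"
  by (simp add: proots_prod) (induction I rule: finite_induct, auto)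

text \<open>
  This replaces the sorted list behind the singular values by an index set: \<open>I\<close> collects the \<open>r\<close> leading
  eigenvectors, and the nuclear norm minus the Ky Fan norm is the sum over the others. The freedom in
  the eigenbasis matters for symmetric \<open>X\<close>, where eigenvectors of \<open>X\<close> itself are needed.
\<close>

lemma singular_value_tail:
  fixes X :: "real^'m^'n" and u :: "'n \<Rightarrow> real^'n"
  assumes on: "orthonormal_family u" and eig: "\<And>i. (X ** transpose X) *v u i = \<nu> i *\<^sub>R u i"
    and r: "r \<le> CARD('n)"
  obtains I where "card I = r" "\<And>i j. i \<in> I \<Longrightarrow> j \<notin> I \<Longrightarrow> sqrt (\<nu> j) \<le> sqrt (\<nu> i)"
    "nuclear_norm X - ky_fan_norm r X = (\<Sum>i\<in>-I. sqrt (\<nu> i))"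
proof -
  define s where "s = (\<lambda>i. sqrt (\<nu> i))"
  obtain ys where ys: "set ys = (UNIV :: 'n set)" "distinct ys" using finite_distinct_list[OF finite[of "UNIV :: 'n set"]] by auto
  define xs where "xs = rev (sort_key s ys)"
  have xs: "set xs = UNIV" "distinct xs" using ys by (simp_all add: xs_def)
  then have len: "length xs = CARD('n)" using distinct_card by fastforce
  have "image_mset sqrt (proots (charpoly (X ** transpose X))) = mset (map s ys)"
    using ys by (simp add: charpoly_of_orthonormal_eigenbasis[OF on eig] proots_prod_linear
        mset_set_set[symmetric] image_mset.compositionality o_def s_def del: mset_set_set)
  then have "singular_values X = rev (sort (map s ys))"
    by (simp only: singular_values_def sorted_list_of_multiset_mset)
  also have "sort (map s ys) = map s (sort_key s ys)"
    by (rule properties_for_sort) simp_all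
  finally have sv: "singular_values X = map s xs" by (simp add: xs_def rev_map)
  have partial: "(\<Sum>i = 1..k. singular_value i X) = (\<Sum>i\<in>set (take k xs). s i)" if "k \<le> CARD('n)" for k
  proof -
    have "(\<Sum>i = 1..k. singular_value i X) = (\<Sum>i<k. map s xs ! i)"
      unfolding singular_value_def sv
      by (rule sum.reindex_bij_witness[of _ Suc "\<lambda>i. i - 1"]) auto
    also have "\<dots> = sum_list (take k (map s xs))"
      using that len by (simp add: sum_list_sum_nth atLeast0LessThan)
    also have "\<dots> = (\<Sum>i\<in>set (take k xs). s i)"
      using xs(2) by (simp add: take_map sum_list_distinct_conv_sum_set)
    finally show ?thesis .
  qed
  define I where "I = set (take r xs)"
  have "sorted_wrt (\<lambda>i j. s j \<le> s i) xs"
    unfolding xs_def sorted_wrt_rev using sorted_sort_key[of s ys] by (simp add: sorted_map)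
  then have "sorted_wrt (\<lambda>i j. s j \<le> s i) (take r xs @ drop r xs)" by simp
  then have "s j \<le> s i" if "i \<in> I" "j \<in> set (drop r xs)" for i j
    using that unfolding sorted_wrt_append I_def by blast
  moreover have "- I \<subseteq> set (drop r xs)"
    using xs(1) append_take_drop_id[of r xs] by (metis Compl_subset_Compl_iff I_def Un_iff UNIV_I ComplD set_append subsetI)
  ultimately have "s j \<le> s i" if "i \<in> I" "j \<notin> I" for i j using that by blast
  moreover have "card I = r"
    unfolding I_def using xs(2) len r by (simp add: distinct_card distinct_take)
  moreover have "nuclear_norm X - ky_fan_norm r X = (\<Sum>i\<in>-I. s i)"
    unfolding nuclear_norm_def ky_fan_norm_def
    using partial[OF r] partial[OF order_refl] len xs(1) sum_diff[of UNIV I s]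
    by (simp add: I_def Compl_eq_Diff_UNIV)
  ultimately show thesis using that unfolding s_def by blast
qed

section \<open>Low-rank approximation\<close>

definition outer_product :: "real^'n \<Rightarrow> real^'m \<Rightarrow> real^'m^'n" where
  "outer_product a b = (\<chi> i j. a $ i * b $ j)"

lemma norm_outer_product: "norm (outer_product a b) = norm a * norm b"
proof -
  have "(norm (outer_product a b))\<^sup>2 = (\<Sum>i\<in>UNIV. \<Sum>j\<in>UNIV. (a $ i * a $ i) * (b $ j * b $ j))"
    unfolding power2_norm_eq_inner by (simp add: outer_product_def inner_vec_def mult_ac)
  also have "\<dots> = (norm a * norm b)\<^sup>2"
    unfolding power_mult_distrib power2_norm_eq_inner by (simp add: inner_vec_def sum_product)
  finally show ?thesis by (rule power2_eq_imp_eq) auto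
qed

lemma outer_product_mult_vec: "outer_product a b *v x = inner b x *\<^sub>R a"
  by (simp add: vec_eq_iff outer_product_def matrix_vector_mult_def inner_vec_def sum_distrib_left mult_ac)

text \<open>
  Multiplying \<open>X\<close> by the resolution of the identity \<open>\<Sum>i. u i (u i)\<^sup>T\<close>; with eigenvectors of
  \<open>X X\<^sup>T\<close> this is the singular value decomposition with the singular values absorbed in the right factor.
\<close>

lemma outer_product_expansion:
  fixes X :: "real^'m^'n" and u :: "'n \<Rightarrow> real^'n"
  assumes "orthonormal_family u"
  shows "X = (\<Sum>i\<in>UNIV. outer_product (u i) (transpose X *v u i))"
proof -
  have "(\<Sum>i\<in>UNIV. outer_product (u i) (transpose X *v u i)) $ a $ b = X $ a $ b" for a b
  proof -
    have "(\<Sum>i\<in>UNIV. outer_product (u i) (transpose X *v u i)) $ a $ b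
        = (\<Sum>i\<in>UNIV. \<Sum>k\<in>UNIV. u i $ a * (X $ k $ b * u i $ k))"
      by (simp add: outer_product_def matrix_vector_mult_def transpose_def sum_distrib_left
          del: transpose_matrix_vector)
    also have "\<dots> = (\<Sum>k\<in>UNIV. X $ k $ b * (\<Sum>i\<in>UNIV. u i $ a * u i $ k))"
      by (subst sum.swap) (simp add: sum_distrib_left mult_ac)
    also have "\<dots> = X $ a $ b"
      by (simp add: orthonormal_family_transpose[OF assms] if_distrib cong: if_cong)
    finally show ?thesis .
  qed
  then show ?thesis by (simp add: vec_eq_iff)
qed

lemma rank_sum_outer_products_le:
  assumes "finite I"
  shows "rank (\<Sum>i\<in>I. outer_product (a i) (b i)) \<le> card I"
proof -
  have *: "(\<Sum>i\<in>I. outer_product (a i) (b i)) *v x = (\<Sum>i\<in>I. inner (b i) x *\<^sub>R a i)" for x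
    using assms by (induction I rule: finite_induct)
      (auto simp: matrix_vector_mult_add_rdistrib outer_product_mult_vec)
  have "range ((*v) (\<Sum>i\<in>I. outer_product (a i) (b i))) \<subseteq> span (a ` I)"
    unfolding * by (auto intro!: span_sum intro: span_scale span_base)
  then have "rank (\<Sum>i\<in>I. outer_product (a i) (b i)) \<le> card (a ` I)"
    unfolding rank_dim_range using assms by (intro dim_le_card) auto
  then show ?thesis using card_image_le[OF assms, of a] by linarith
qed

lemma norm_matrix_vector_mult_le: "norm (A *v x) \<le> norm (A :: real^'m^'n) * norm x"
proof -
  have "(norm (A *v x))\<^sup>2 = (\<Sum>i\<in>UNIV. (inner (A $ i) x)\<^sup>2)"
    unfolding power2_norm_eq_inner by (simp add: inner_vec_def matrix_vector_mul_component power2_eq_square)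
  also have "\<dots> \<le> (\<Sum>i\<in>UNIV. (norm (A $ i) * norm x)\<^sup>2)"
    by (intro sum_mono) (metis Cauchy_Schwarz_ineq2 abs_ge_zero power2_abs power_mono)
  also have "\<dots> = (\<Sum>i\<in>UNIV. (norm (A $ i))\<^sup>2) * (norm x)\<^sup>2"
    by (simp add: power_mult_distrib sum_distrib_right)
  also have "(\<Sum>i\<in>UNIV. (norm (A $ i))\<^sup>2) = (norm A)\<^sup>2"
    by (simp add: norm_vec_def L2_set_def sum_nonneg)
  finally show ?thesis by (auto intro: power2_le_imp_le simp: power_mult_distrib)
qed

lemma norm_transpose: "norm (transpose A) = norm (A :: real^'m^'n)"
proof -
  have "(norm (transpose A))\<^sup>2 = (norm A)\<^sup>2"
    unfolding power2_norm_eq_inner inner_vec_def transpose_def by (simp add: sum.swap[of _ "UNIV :: 'm set"])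
  then show ?thesis by (rule power2_eq_imp_eq) auto
qed

lemma norm_sq_transpose_mult_vec:
  fixes X :: "real^'m^'n"
  shows "(norm (transpose X *v w))\<^sup>2 = inner w ((X ** transpose X) *v w)"
  unfolding power2_norm_eq_inner
  by (metis dot_lmul_matrix matrix_vector_mul_assoc transpose_matrix_vector)

lemma norm_transpose_mult_eigenvector:
  fixes X :: "real^'m^'n" and u :: "'n \<Rightarrow> real^'n"
  assumes "orthonormal_family u" "\<And>i. (X ** transpose X) *v u i = \<nu> i *\<^sub>R u i"
  shows "norm (transpose X *v u i) = sqrt (\<nu> i)"
proof -
  have "(norm (transpose X *v u i))\<^sup>2 = \<nu> i"
    using assms unfolding norm_sq_transpose_mult_vec by (simp add: orthonormal_family_def)
  then show ?thesis by (metis real_sqrt_unique norm_ge_zero)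
qed

text \<open>
  Truncating the expansion of \<open>X\<close> to the leading indices leaves terms of norm \<open>sqrt (\<nu> i)\<close>, so the
  triangle inequality bounds the error by the tail sum. The truncation is kept explicit, since its symmetry
  has to be recognised later.
\<close>

lemma singular_value_tail_low_rank_approximation:
  fixes X :: "real^'m^'n" and u :: "'n \<Rightarrow> real^'n"
  assumes on: "orthonormal_family u" and eig: "\<And>i. (X ** transpose X) *v u i = \<nu> i *\<^sub>R u i"
    and r: "r \<le> CARD('n)"
  obtains I where "rank (\<Sum>i\<in>I. outer_product (u i) (transpose X *v u i)) \<le> r"
    "norm (X - (\<Sum>i\<in>I. outer_product (u i) (transpose X *v u i))) \<le> nuclear_norm X - ky_fan_norm r X"
proof -
  obtain I where I: "card I = r" "nuclear_norm X - ky_fan_norm r X = (\<Sum>i\<in>-I. sqrt (\<nu> i))"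
    using singular_value_tail[OF on eig r] by metis
  let ?T = "\<lambda>i. outer_product (u i) (transpose X *v u i)"
  have "X - sum ?T I = sum ?T (- I)"
    using outer_product_expansion[OF on, of X] sum_diff[of UNIV I ?T]
    by (metis (no_types, lifting) Compl_eq_Diff_UNIV finite subset_UNIV)
  also have "norm \<dots> \<le> (\<Sum>i\<in>-I. norm (?T i))" by (rule norm_sum)
  also have "\<dots> = (\<Sum>i\<in>-I. sqrt (\<nu> i))"
  proof (rule sum.cong)
    fix i
    have "norm (u i) = 1" using on by (simp add: orthonormal_family_def norm_eq_1)
    then show "norm (?T i) = sqrt (\<nu> i)"
      by (simp add: norm_outer_product norm_transpose_mult_eigenvector[OF on eig] del: transpose_matrix_vector)
  qed simp
  finally show thesis using that[of I] I rank_sum_outer_products_le[of I] by (metis finite)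
qed

lemma kernel_vector_in_span:
  fixes Y :: "real^'m^'n"
  assumes B: "independent B" "rank Y < card B"
  obtains w where "w \<in> span B" "w \<noteq> 0" "Y *v w = 0"
proof -
  have "\<not> inj_on ((*v) Y) (span B)"
  proof
    assume "inj_on ((*v) Y) (span B)"
    then have "dim ((*v) Y ` span B) = dim (span B)"
      by (intro dim_image_eq) (simp_all add: span_span)
    also have "\<dots> = card B" using B(1) by (rule dim_span_eq_card_independent)
    finally have "card B \<le> rank Y" unfolding rank_dim_range by (metis dim_subset image_mono subset_UNIV)
    then show False using B(2) by simp
  qed
  then obtain x y where "x \<in> span B" "y \<in> span B" "x \<noteq> y" "Y *v x = Y *v y"
    unfolding inj_on_def by blast
  then show thesis
    using that[of "x - y"] by (simp add: span_diff matrix_vector_mult_diff_distrib)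
qed

text \<open>
  A weak form of the Eckart-Young theorem. Each tail singular value is at most the largest one,
  \<open>sqrt (\<nu> j)\<close>, so it suffices to bound that one by \<open>norm (X - Y)\<close>. The leading \<open>r\<close> eigenvectors
  together with \<open>u j\<close> span a space of dimension \<open>r + 1\<close>, on which the rank of \<open>Y\<close> does not permit
  \<open>transpose Y\<close> to be injective; so it contains a nonzero \<open>w\<close> with
  \<open>transpose Y *v w = 0\<close>. On that space \<open>transpose X\<close> stretches by at least \<open>sqrt (\<nu> j)\<close>, while at
  \<open>w\<close> it agrees with \<open>transpose (X - Y)\<close>.
\<close>

lemma singular_value_tail_le:
  fixes X Y :: "real^'m^'n"
  assumes r: "r \<le> CARD('n)" and Y: "rank Y \<le> r"
  shows "nuclear_norm X - ky_fan_norm r X \<le> real CARD('n) * norm (X - Y)"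
proof -
  have "transpose (X ** transpose X) = X ** transpose X" by (simp add: matrix_transpose_mul)
  from spectral_theorem[OF this] obtain u :: "'n \<Rightarrow> real^'n" and \<nu> where on: "orthonormal_family u" and eig: "\<And>i. (X ** transpose X) *v u i = \<nu> i *\<^sub>R u i"
    by metis
  obtain I where I: "card I = r" "\<And>i j. i \<in> I \<Longrightarrow> j \<notin> I \<Longrightarrow> sqrt (\<nu> j) \<le> sqrt (\<nu> i)"
    and tail: "nuclear_norm X - ky_fan_norm r X = (\<Sum>i\<in>-I. sqrt (\<nu> i))"
    using singular_value_tail[OF on eig r] by metis
  have each: "sqrt (\<nu> j) \<le> norm (X - Y)" if jI: "j \<notin> I" and jmax: "\<And>i. i \<notin> I \<Longrightarrow> sqrt (\<nu> i) \<le> sqrt (\<nu> j)" for j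
  proof -
    define J where "J = insert j I"
    have inj: "inj u" using on by (metis orthonormal_family_def injI zero_neq_one)
    have "independent (u ` J)"
    proof (rule pairwise_orthogonal_independent)
      show "pairwise orthogonal (u ` J)"
        using on by (auto simp: pairwise_def orthogonal_def orthonormal_family_def)
      show "0 \<notin> u ` J" using on unfolding orthonormal_family_def by (metis imageE inner_zero_left zero_neq_one)
    qed
    moreover have "card (u ` J) = Suc r"
      unfolding card_image[OF inj_on_subset[OF inj subset_UNIV]] using jI I(1) by (simp add: J_def)
    ultimately obtain w where w: "w \<in> span (u ` J)" "w \<noteq> 0" "transpose Y *v w = 0"
      using kernel_vector_in_span[of "u ` J" "transpose Y"] Y by (auto simp: rank_transpose)
    obtain c where "w = (\<Sum>v\<in>u ` J. c v *\<^sub>R v)" using w(1) by (auto simp: span_finite)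
    then have wc: "w = (\<Sum>i\<in>J. c (u i) *\<^sub>R u i)" by (simp add: sum.reindex[OF inj_on_subset[OF inj subset_UNIV]])
    have coef: "inner (u k) (\<Sum>i\<in>J. a i *\<^sub>R u i) = (if k \<in> J then a k else 0)" for k a
      by (simp add: inner_sum_right on[unfolded orthonormal_family_def, rule_format] if_distrib cong: if_cong)
    have ww: "inner w (\<Sum>i\<in>J. a i *\<^sub>R u i) = (\<Sum>i\<in>J. c (u i) * a i)" for a
      by (subst wc) (simp add: inner_sum_left coef)
    have "(X ** transpose X) *v w = (\<Sum>i\<in>J. (c (u i) * \<nu> i) *\<^sub>R u i)"
      by (subst wc) (simp add: linear_sum[OF matrix_vector_mul_linear] matrix_vector_mult_scaleR eig)
    then have Xw: "(norm (transpose X *v w))\<^sup>2 = (\<Sum>i\<in>J. \<nu> i * (c (u i))\<^sup>2)"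
      unfolding norm_sq_transpose_mult_vec by (simp only: ww) (simp add: power2_eq_square mult_ac)
    have "transpose (X - Y) = transpose X - transpose Y" by (simp add: vec_eq_iff transpose_def)
    then have same: "transpose (X - Y) *v w = transpose X *v w"
      by (simp only: matrix_vector_mult_diff_rdistrib w(3) diff_0_right)
    have "(norm w)\<^sup>2 = (\<Sum>i\<in>J. (c (u i))\<^sup>2)"
      unfolding power2_norm_eq_inner by (subst (2) wc) (simp only: ww power2_eq_square)
    then have "\<nu> j * (norm w)\<^sup>2 = (\<Sum>i\<in>J. \<nu> j * (c (u i))\<^sup>2)" by (simp add: sum_distrib_left)
    also have "\<dots> \<le> (\<Sum>i\<in>J. \<nu> i * (c (u i))\<^sup>2)"
      using I(2) jI by (intro sum_mono mult_right_mono) (auto simp: J_def)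
    also have "\<dots> = (norm (transpose (X - Y) *v w))\<^sup>2"
      by (simp only: same Xw)
    also have "\<dots> \<le> (norm (X - Y) * norm w)\<^sup>2"
      using norm_matrix_vector_mult_le[of "transpose (X - Y)" w] by (intro power_mono) (simp_all add: norm_transpose del: transpose_matrix_vector)
    finally have "\<nu> j \<le> (norm (X - Y))\<^sup>2" using w(2) by (simp add: power_mult_distrib)
    then show ?thesis by (simp add: real_le_lsqrt)
  qed
  show ?thesis
  proof (cases "- I = {}")
    case True
    then show ?thesis by (simp add: tail)
  next
    case False
    then obtain j where j: "j \<notin> I" "\<And>i. i \<notin> I \<Longrightarrow> sqrt (\<nu> i) \<le> sqrt (\<nu> j)"
      using ex_is_arg_min_if_finite[of "- I" "\<lambda>i. - sqrt (\<nu> i)"] by (force simp: is_arg_min_linorder)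
    have "(\<Sum>i\<in>-I. sqrt (\<nu> i)) \<le> of_nat (card (- I)) * norm (X - Y)"
      by (intro sum_bounded_above order_trans[OF j(2) each[OF j]]) simp
    also have "\<dots> \<le> real CARD('n) * norm (X - Y)"
      by (intro mult_right_mono) (auto intro: card_mono)
    finally show ?thesis by (simp add: tail)
  qed
qed

text \<open>
  The truncation stays symmetric when the eigenbasis of \<open>X X\<^sup>T\<close> is one of \<open>X\<close>: its terms are then
  multiples of \<open>u i (u i)\<^sup>T\<close>. An arbitrary eigenbasis of \<open>X X\<^sup>T\<close> would not do, as \<open>X\<close> may have
  both \<open>\<mu>\<close> and \<open>- \<mu>\<close> as eigenvalues.
\<close>

lemma symmetric_low_rank_approximation:
  fixes X :: "real^'n^'n"
  assumes X: "X \<in> sym_matrices" and r: "r \<le> CARD('n)"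
  shows "\<exists>Y\<in>Lambda_set sym_matrices r. norm (X - Y) \<le> nuclear_norm X - ky_fan_norm r X"
proof -
  have sym: "transpose X = X" using X by (simp add: sym_matrices_def)
  obtain u :: "'n \<Rightarrow> real^'n" and \<mu> where on: "orthonormal_family u" and eig: "\<And>i. X *v u i = \<mu> i *\<^sub>R u i"
    using spectral_theorem[OF sym] by metis
  have gram: "(X ** transpose X) *v u i = (\<mu> i * \<mu> i) *\<^sub>R u i" for i
    by (simp add: sym matrix_vector_mul_assoc[symmetric] eig matrix_vector_mult_scaleR)
  obtain I where I: "rank (\<Sum>i\<in>I. outer_product (u i) (transpose X *v u i)) \<le> r"
    "norm (X - (\<Sum>i\<in>I. outer_product (u i) (transpose X *v u i))) \<le> nuclear_norm X - ky_fan_norm r X"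
    by (rule singular_value_tail_low_rank_approximation[OF on gram r])
  have "transpose (\<Sum>i\<in>I. outer_product (u i) (transpose X *v u i))
      = (\<Sum>i\<in>I. outer_product (u i) (transpose X *v u i))"
    unfolding sym eig by (simp add: vec_eq_iff transpose_def outer_product_def mult_ac)
  then show ?thesis using I by (auto simp: Lambda_set_def sym_matrices_def simp del: transpose_matrix_vector)
qed

lemma rectangular_low_rank_approximation:
  fixes X :: "real^'m^'n"
  assumes r: "r \<le> CARD('n)"
  shows "\<exists>Y\<in>Lambda_set UNIV r. norm (X - Y) \<le> nuclear_norm X - ky_fan_norm r X"
proof -
  have "transpose (X ** transpose X) = X ** transpose X" by (simp add: matrix_transpose_mul)
  from spectral_theorem[OF this] obtain u :: "'n \<Rightarrow> real^'n" and \<nu> where "orthonormal_family u" "\<And>i. (X ** transpose X) *v u i = \<nu> i *\<^sub>R u i"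
    by metis
  then obtain I where "rank (\<Sum>i\<in>I. outer_product (u i) (transpose X *v u i)) \<le> r"
    "norm (X - (\<Sum>i\<in>I. outer_product (u i) (transpose X *v u i))) \<le> nuclear_norm X - ky_fan_norm r X"
    by (rule singular_value_tail_low_rank_approximation[OF _ _ r])
  then show ?thesis unfolding Lambda_set_def by blast
qed

section \<open>Calmness of the rank residual\<close>

text \<open>
  The common part of the rectangular and the symmetric case: only the existence of a good low-rank
  approximation inside \<open>V\<close> depends on the matrix space.
\<close>

lemma rank_residual_calmness:
  fixes V \<Omega> :: "(real^'m^'n) set" and Xb :: "real^'m^'n"
  assumes V: "subspace V" and \<Omega>: "closed \<Omega>" "\<Omega> \<subseteq> V" and r: "r \<le> CARD('n)"
    and Xb: "Xb \<in> Gamma_set \<Omega> r"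
    and approx: "\<And>X. X \<in> V \<Longrightarrow> \<exists>Y\<in>Lambda_set V r. norm (X - Y) \<le> nuclear_norm X - ky_fan_norm r X"
  shows
    "(calm_at V (S_map \<Omega> r) 0 Xb \<longleftrightarrow>
       (\<exists>\<gamma>\<ge>0. \<exists>\<delta>>0. \<forall>X\<in>V. norm (X - Xb) \<le> \<delta> \<longrightarrow>
          edist_set X (Gamma_set \<Omega> r) \<le>
            ereal \<gamma> * (edist_set X \<Omega> + edist_set X (Lambda_set V r)))) \<and>
     (calm_at V (S_map \<Omega> r) 0 Xb \<longleftrightarrow>
       subregular_at (V \<times> V) (F_map V \<Omega> r) (Xb, Xb) 0) \<and>
     (uminus ` limiting_normal_cone V \<Omega> Xb \<inter> limiting_normal_cone V (Lambda_set V r) Xb = {0} \<longrightarrow>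
       calm_at V (S_map \<Omega> r) 0 Xb)"
proof -
  interpret constraint_residual V \<Omega> "Lambda_set V r" "\<lambda>X. nuclear_norm X - ky_fan_norm r X"
    "real CARD('n)" Xb
  proof
    show "nuclear_norm X - ky_fan_norm r X \<le> real CARD('n) * norm (X - Y)"
      if "Y \<in> Lambda_set V r" for X Y :: "real^'m^'n"
      using singular_value_tail_le[OF r, of Y X] that by (simp add: Lambda_set_def)
  qed (use V \<Omega> Xb approx in \<open>auto simp: Gamma_set_def Lambda_set_def\<close>)
  have \<Gamma>: "Gamma_set \<Omega> r = \<Omega> \<inter> Lambda_set V r"
    using \<Omega> by (auto simp: Gamma_set_def Lambda_set_def)
  have S: "S_map \<Omega> r = (\<lambda>\<tau>. {X\<in>\<Omega>. nuclear_norm X - ky_fan_norm r X = \<tau>})"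
    by (simp add: S_map_def fun_eq_iff)
  show ?thesis
    unfolding S \<Gamma> F_map_def calm_iff_error_bound linear_regularity_iff_error_bound
      subregular_iff_error_bound
    using transversality_imp_error_bound by blast
qed

lemma subspace_sym_matrices: "subspace sym_matrices"
  by (auto simp: sym_matrices_def subspace_def transpose_def vec_eq_iff)

theorem theorem3p1:
  shows
    "(CARD('n::finite) \<le> CARD('m::finite) \<longrightarrow>
      (\<forall>(\<Omega> :: (real^'m^'n) set) (r :: nat) (Xb :: real^'m^'n).
        closed \<Omega> \<and> \<Omega> \<subseteq> UNIV \<and> r \<in> {1..CARD('n)} \<and>
        Gamma_set \<Omega> r \<noteq> {} \<and> Xb \<in> Gamma_set \<Omega> r \<longrightarrow>
          (calm_at UNIV (S_map \<Omega> r) 0 Xb \<longleftrightarrow>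
             (\<exists>\<gamma>\<ge>0. \<exists>\<delta>>0. \<forall>X\<in>UNIV. norm (X - Xb) \<le> \<delta> \<longrightarrow>
                edist_set X (Gamma_set \<Omega> r) \<le>
                  ereal \<gamma> * (edist_set X \<Omega> + edist_set X (Lambda_set UNIV r)))) \<and>
          (calm_at UNIV (S_map \<Omega> r) 0 Xb \<longleftrightarrow>
             subregular_at (UNIV \<times> UNIV) (F_map UNIV \<Omega> r) (Xb, Xb) 0) \<and>
          (uminus ` limiting_normal_cone UNIV \<Omega> Xb \<inter>
             limiting_normal_cone UNIV (Lambda_set UNIV r) Xb = {0} \<longrightarrow>
             calm_at UNIV (S_map \<Omega> r) 0 Xb))) \<and>
     (\<forall>(\<Omega> :: (real^'n^'n) set) (r :: nat) (Xb :: real^'n^'n).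
        closed \<Omega> \<and> \<Omega> \<subseteq> sym_matrices \<and> r \<in> {1..CARD('n)} \<and>
        Gamma_set \<Omega> r \<noteq> {} \<and> Xb \<in> Gamma_set \<Omega> r \<longrightarrow>
          (calm_at sym_matrices (S_map \<Omega> r) 0 Xb \<longleftrightarrow>
             (\<exists>\<gamma>\<ge>0. \<exists>\<delta>>0. \<forall>X\<in>sym_matrices. norm (X - Xb) \<le> \<delta> \<longrightarrow>
                edist_set X (Gamma_set \<Omega> r) \<le>
                  ereal \<gamma> * (edist_set X \<Omega> + edist_set X (Lambda_set sym_matrices r)))) \<and>
          (calm_at sym_matrices (S_map \<Omega> r) 0 Xb \<longleftrightarrow>
             subregular_at (sym_matrices \<times> sym_matrices) (F_map sym_matrices \<Omega> r) (Xb, Xb) 0) \<and>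
          (uminus ` limiting_normal_cone sym_matrices \<Omega> Xb \<inter>
             limiting_normal_cone sym_matrices (Lambda_set sym_matrices r) Xb = {0} \<longrightarrow>
             calm_at sym_matrices (S_map \<Omega> r) 0 Xb))"
proof -
  note rect = rank_residual_calmness[OF subspace_UNIV _ subset_UNIV _ _ rectangular_low_rank_approximation]
  note sym = rank_residual_calmness[OF subspace_sym_matrices _ _ _ _ symmetric_low_rank_approximation]
  show ?thesis
    by (rule conjI; intro impI allI; elim conjE; (rule rect | rule sym)) simp_all
qed

end
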